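(* Let a Lie group $G$ act regularly on a manifold $M$ with slice $\mathcal S\subset M$ having isotropy group $H$. Let $[\rho]:J^n(M,p)\to H\backslash G$ be the induced equivariant map, $\rho_s=s\circ[\rho]$ for a local section $s:H\backslash G\to G$ with $s[H]=e$, and $\iota_0(z^{(n)})=\rho_s(z^{(n)})\cdot z^{(n)}$. Let $n$ be the order of stabilization, $\mathcal S^n=\{z^{(n)}\in J^n(M,p):\pi^n_0(z^{(n)})\in\mathcal S\}$, and let $\rho_H:\mathcal S^n\to H$ be a moving frame for the action of $H$ on $\mathcal S^n$. Then the map $\rho_G:J^n(M,p)\to G$ defined by $$\rho_G(z^{(n)})=\rho_H\big(\iota_0(z^{(n)})\big)\,\rho_s(z^{(n)})$$ is $G$-equivariant: $\rho_G(g\cdot z^{(n)})=\rho_G(z^{(n)})\,g^{-1}$ for $g\in G$.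
   Context: $J^n(M,p)$ is the bundle of $n$-th order jets of $p$-dimensional submanifolds of $M$ with projection $\pi^n_0:J^n\to M$; $G$ acts on it by prolongation. The order of stabilization is the minimal order at which the maximal orbit dimension of the prolonged actions is attained. A slice is a submanifold $\mathcal S\subset M$ which is a cross-section to the $G$-orbits (of complementary dimension, meeting each orbit transversally, and each orbit in exactly one point) and all of whose points have the same isotropy group $H$; then $\mathcal S^n$ is invariant under the prolonged action of $H$. The map $[\rho]:M\to H\backslash G$ (right cosets) is defined by $[\rho](z)=Hg$ where $g\cdot z\in\mathcal S$, and is extended to $J^n$ by composition with $\pi^n_0$. A moving frame for $H$ on $\mathcal S^n$ is a map with $\rho_H(h\cdot z)=\rho_H(z)h^{-1}$ for $h\in H$. All maps may be only locally defined; the identities hold wherever both sides are defined. *)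

theory Defs
  imports "HOL-Analysis.Analysis" "HOL-Algebra.Group_Action"
begin

section \<open>Smooth functions\<close>

text \<open>\<open>Ck_on k S f\<close> is meant for open \<open>S\<close>.\<close>

primrec Ck_on :: "nat \<Rightarrow> 'a::euclidean_space set \<Rightarrow> ('a \<Rightarrow> 'b::euclidean_space) \<Rightarrow> bool" where
  "Ck_on 0 S f \<longleftrightarrow> continuous_on S f"
| "Ck_on (Suc k) S f \<longleftrightarrow>
     f differentiable_on S \<and> (\<forall>v. Ck_on k S (\<lambda>x. frechet_derivative f (at x) v))"

text \<open>Smoothness on an arbitrary subset of a Euclidean space: local extendability to a
  smooth function on an open set.  This is needed because charts take values in a linear subspace
  of a Euclidean space, so that the dimension of a manifold is a number (possibly 0) and is not
  determined by a type.\<close>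

definition smooth_on :: "'a::euclidean_space set \<Rightarrow> ('a \<Rightarrow> 'b::euclidean_space) \<Rightarrow> bool" where
  "smooth_on S f \<longleftrightarrow>
     (\<forall>x\<in>S. \<exists>T F. open T \<and> x \<in> T \<and> (\<forall>k. Ck_on k T F) \<and> (\<forall>y\<in>S \<inter> T. F y = f y))"

text \<open>Iterated directional derivative; on lists of basis vectors these are the
  mixed partial derivatives.\<close>

primrec iter_deriv ::
    "'a list \<Rightarrow> ('a::euclidean_space \<Rightarrow> 'b::euclidean_space) \<Rightarrow> 'a \<Rightarrow> 'b" where
  "iter_deriv [] f = f"
| "iter_deriv (v # vs) f = iter_deriv vs (\<lambda>x. frechet_derivative f (at x) v)"


section \<open>Manifolds and smooth maps\<close>

text \<open>A manifold on the points of a type \<open>'a\<close>, modelled on a linear subspace of \<open>'e\<close>.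
  A chart is a pair of its domain and a map that is relevant on this domain only.\<close>

record ('a, 'e) manifold =
  model :: "'e set"
  charts :: "('a set \<times> ('a \<Rightarrow> 'e)) set"

definition chart_on ::
    "'e::euclidean_space set \<Rightarrow> 'a::topological_space set \<Rightarrow> ('a \<Rightarrow> 'e) \<Rightarrow> bool" where
  "chart_on E U c \<longleftrightarrow> open U \<and> openin (top_of_set E) (c ` U) \<and> (\<exists>k. homeomorphism U (c ` U) c k)"

definition compatible_charts ::
    "'a set \<Rightarrow> ('a \<Rightarrow> 'e::euclidean_space) \<Rightarrow> 'a set \<Rightarrow> ('a \<Rightarrow> 'e) \<Rightarrow> bool" where
  "compatible_charts U c V d \<longleftrightarrow>
     smooth_on (c ` (U \<inter> V)) (d \<circ> inv_into U c) \<and> smooth_on (d ` (U \<inter> V)) (c \<circ> inv_into V d)"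

text \<open>The set of charts is required to be a maximal smooth atlas.\<close>

definition smooth_manifold ::
    "('a::{t2_space,second_countable_topology}, 'e::euclidean_space) manifold \<Rightarrow> bool" where
  "smooth_manifold M \<longleftrightarrow>
     subspace (model M) \<and>
     (\<forall>(U, c)\<in>charts M. chart_on (model M) U c) \<and>
     (\<Union>(U, c)\<in>charts M. U) = UNIV \<and>
     (\<forall>(U, c)\<in>charts M. \<forall>(V, d)\<in>charts M. compatible_charts U c V d) \<and>
     (\<forall>U c. chart_on (model M) U c \<and> (\<forall>(V, d)\<in>charts M. compatible_charts U c V d)
        \<longrightarrow> (U, c) \<in> charts M)"

definition euclid :: "('e::euclidean_space, 'e) manifold" where
  "euclid = \<lparr>model = UNIV, charts = {(UNIV, \<lambda>x. x)}\<rparr>"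

text \<open>The product is only equipped with the (non-maximal) atlas of product charts, which suffices for testing smoothness.\<close>

definition prod_manifold ::
    "('a, 'e) manifold \<Rightarrow> ('b, 'f) manifold \<Rightarrow> ('a \<times> 'b, 'e \<times> 'f) manifold" where
  "prod_manifold M N =
     \<lparr>model = model M \<times> model N,
      charts = {(U \<times> V, map_prod c d) | U c V d. (U, c) \<in> charts M \<and> (V, d) \<in> charts N}\<rparr>"

definition smooth_map_on ::
    "('a::topological_space, 'e::euclidean_space) manifold \<Rightarrow>
     ('b::topological_space, 'f::euclidean_space) manifold \<Rightarrow> 'a set \<Rightarrow> ('a \<Rightarrow> 'b) \<Rightarrow> bool" where
  "smooth_map_on M N W f \<longleftrightarrow>
     open W \<and> continuous_on W f \<and>
     (\<forall>(U, c)\<in>charts M. \<forall>(V, d)\<in>charts N.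
        smooth_on (c ` (U \<inter> W \<inter> f -` V)) (d \<circ> f \<circ> inv_into U c))"

definition submanifold ::
    "('a, 'e::euclidean_space) manifold \<Rightarrow> nat \<Rightarrow> 'a set \<Rightarrow> bool" where
  "submanifold M k N \<longleftrightarrow>
     (\<forall>x\<in>N. \<exists>(U, c)\<in>charts M. x \<in> U \<and>
        (\<exists>L. subspace L \<and> L \<subseteq> model M \<and> dim L = k \<and> c ` (N \<inter> U) = c ` U \<inter> L))"

definition submanifold_dim :: "('a, 'e::euclidean_space) manifold \<Rightarrow> 'a set \<Rightarrow> nat" where
  "submanifold_dim M N = (THE k. submanifold M k N)"

text \<open>Tangent vectors at \<open>z\<close> to a subset \<open>X\<close>, in the coordinates of a chart \<open>c\<close> around \<open>z\<close>.\<close>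

definition tangent_vectors ::
    "('a::topological_space, 'e::euclidean_space) manifold \<Rightarrow> ('a \<Rightarrow> 'e) \<Rightarrow> 'a \<Rightarrow> 'a set \<Rightarrow> 'e set" where
  "tangent_vectors M c z X =
     {v. \<exists>\<epsilon>>0. \<exists>\<gamma>. smooth_map_on euclid M {-\<epsilon><..<\<epsilon>::real} \<gamma> \<and> \<gamma> 0 = z \<and> \<gamma> ` {-\<epsilon><..<\<epsilon>} \<subseteq> X \<and>
          ((c \<circ> \<gamma>) has_vector_derivative v) (at 0)}"


section \<open>Lie groups and their actions\<close>

definition lie_group ::
    "'g::{t2_space,second_countable_topology} monoid \<Rightarrow> ('g, 'f::euclidean_space) manifold \<Rightarrow> bool" where
  "lie_group G A \<longleftrightarrow>
     group G \<and> carrier G = UNIV \<and> smooth_manifold A \<and>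
     smooth_map_on (prod_manifold A A) A UNIV (\<lambda>(g, h). g \<otimes>\<^bsub>G\<^esub> h) \<and>
     smooth_map_on A A UNIV (\<lambda>g. inv\<^bsub>G\<^esub> g)"

definition lie_group_action ::
    "'g::topological_space monoid \<Rightarrow> ('g, 'f::euclidean_space) manifold \<Rightarrow>
     ('a::topological_space, 'e::euclidean_space) manifold \<Rightarrow> ('g \<Rightarrow> 'a \<Rightarrow> 'a) \<Rightarrow> bool" where
  "lie_group_action G A M act \<longleftrightarrow>
     group_action G UNIV act \<and>
     smooth_map_on (prod_manifold A M) M UNIV (\<lambda>(g, z). act g z)"

text \<open>The orbit through \<open>x\<close> carries the manifold structure of the homogeneous space of \<open>G\<close>
  modulo the (closed) isotropy group of \<open>x\<close>, and this gives its dimension.  The definition is used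
  both for the action on the manifold and for the prolonged actions on jets.\<close>

definition orbit_dim ::
    "'g monoid \<Rightarrow> ('g, 'f::euclidean_space) manifold \<Rightarrow> ('g \<Rightarrow> 'x \<Rightarrow> 'x) \<Rightarrow> 'x \<Rightarrow> nat" where
  "orbit_dim G A act x = dim (model A) - submanifold_dim A (stabilizer G act x)"

text \<open>All orbits have the same dimension, and there are arbitrarily small neighbourhoods of each
  point meeting each orbit in a pathwise connected set.\<close>

definition regular_action ::
    "'g monoid \<Rightarrow> ('g, 'f::euclidean_space) manifold \<Rightarrow> ('g \<Rightarrow> 'a::topological_space \<Rightarrow> 'a) \<Rightarrow> bool"
  where
  "regular_action G A act \<longleftrightarrow>
     (\<exists>d. \<forall>z. orbit_dim G A act z = d) \<and>
     (\<forall>z T. open T \<and> z \<in> T \<longrightarrow>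
        (\<exists>U. open U \<and> z \<in> U \<and> U \<subseteq> T \<and> (\<forall>w. path_connected (U \<inter> orbit G act w))))"

definition cross_section ::
    "'g monoid \<Rightarrow> ('g, 'f::euclidean_space) manifold \<Rightarrow>
     ('a::topological_space, 'e::euclidean_space) manifold \<Rightarrow> ('g \<Rightarrow> 'a \<Rightarrow> 'a) \<Rightarrow> 'a set \<Rightarrow> bool" where
  "cross_section G A M act S \<longleftrightarrow>
     (\<exists>k. submanifold M k S \<and> (\<forall>z\<in>S. k + orbit_dim G A act z = dim (model M))) \<and>
     (\<forall>z\<in>S. \<forall>(U, c)\<in>charts M. z \<in> U \<longrightarrow>
        {v + w | v w. v \<in> tangent_vectors M c z S \<and> w \<in> tangent_vectors M c z (orbit G act z)}
          = model M) \<and>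
     (\<forall>z. \<exists>!w. w \<in> S \<inter> orbit G act z)"

definition slice ::
    "'g monoid \<Rightarrow> ('g, 'f::euclidean_space) manifold \<Rightarrow>
     ('a::topological_space, 'e::euclidean_space) manifold \<Rightarrow> ('g \<Rightarrow> 'a \<Rightarrow> 'a) \<Rightarrow> 'a set \<Rightarrow> 'g set \<Rightarrow> bool"
  where
  "slice G A M act S H \<longleftrightarrow>
     cross_section G A M act S \<and> (\<forall>z\<in>S. stabilizer G act z = H)"

definition slice_map ::
    "'g monoid \<Rightarrow> ('g \<Rightarrow> 'a \<Rightarrow> 'a) \<Rightarrow> 'a set \<Rightarrow> 'g set \<Rightarrow> 'a \<Rightarrow> 'g set" where
  "slice_map G act S H z = (THE C. \<exists>g\<in>carrier G. act g z \<in> S \<and> C = H #>\<^bsub>G\<^esub> g)"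

text \<open>A smooth local section of the projection of \<open>G\<close> onto the right cosets of \<open>H\<close>, with open
  domain \<open>W\<close>.  The projection is a surjective submersion, so openness of \<open>W\<close> and smoothness of \<open>s\<close>
  are expressed on \<open>G\<close>.\<close>

definition local_section ::
    "'g::topological_space monoid \<Rightarrow> ('g, 'f::euclidean_space) manifold \<Rightarrow> 'g set \<Rightarrow>
     'g set set \<Rightarrow> ('g set \<Rightarrow> 'g) \<Rightarrow> bool" where
  "local_section G A H W s \<longleftrightarrow>
     W \<subseteq> rcosets\<^bsub>G\<^esub> H \<and>
     (\<forall>C\<in>W. s C \<in> carrier G \<and> H #>\<^bsub>G\<^esub> s C = C) \<and>
     smooth_map_on A A {g \<in> carrier G. H #>\<^bsub>G\<^esub> g \<in> W} (\<lambda>g. s (H #>\<^bsub>G\<^esub> g))"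

text \<open>A locally defined moving frame with domain \<open>D\<close> for the action of a group \<open>K\<close>.\<close>

definition moving_frame_on ::
    "'g monoid \<Rightarrow> 'g set \<Rightarrow> ('g \<Rightarrow> 'x \<Rightarrow> 'x) \<Rightarrow> 'x set \<Rightarrow> ('x \<Rightarrow> 'g) \<Rightarrow> bool" where
  "moving_frame_on G K act D \<rho> \<longleftrightarrow>
     \<rho> ` D \<subseteq> K \<and>
     (\<forall>h\<in>K. \<forall>x\<in>D. act h x \<in> D \<longrightarrow> \<rho> (act h x) = \<rho> x \<otimes>\<^bsub>G\<^esub> inv\<^bsub>G\<^esub> h)"


section \<open>Jets of submanifolds\<close>

text \<open>Throughout, \<open>p = CARD('p)\<close>.  A local parametrization is a smooth immersion of an open
  neighbourhood of 0 that is a homeomorphism onto a neighbourhood of \<open>z\<close> in \<open>N\<close>.\<close>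

definition local_parametrization ::
    "('a::topological_space, 'e::euclidean_space) manifold \<Rightarrow> 'a set \<Rightarrow> 'a \<Rightarrow>
     (real ^ 'p) set \<Rightarrow> (real ^ 'p \<Rightarrow> 'a) \<Rightarrow> bool" where
  "local_parametrization M N z V \<phi> \<longleftrightarrow>
     0 \<in> V \<and> \<phi> 0 = z \<and> smooth_map_on euclid M V \<phi> \<and>
     (\<forall>x\<in>V. \<forall>(U, c)\<in>charts M. \<phi> x \<in> U \<longrightarrow> inj (frechet_derivative (c \<circ> \<phi>) (at x))) \<and>
     openin (top_of_set N) (\<phi> ` V) \<and> (\<exists>\<psi>. homeomorphism V (\<phi> ` V) \<phi> \<psi>)"

definition submanifolds_through ::
    "'p itself \<Rightarrow> ('a, 'e::euclidean_space) manifold \<Rightarrow> 'a \<Rightarrow> 'a set set" where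
  "submanifolds_through P M z = {N. submanifold M CARD('p) N \<and> z \<in> N}"

text \<open>Contact of order \<open>n\<close> at \<open>z\<close>: for suitable local parametrizations the Taylor
  coefficients up to order \<open>n\<close> agree in all charts.\<close>

definition contact ::
    "'p::finite itself \<Rightarrow> ('a::topological_space, 'e::euclidean_space) manifold \<Rightarrow> nat \<Rightarrow> 'a \<Rightarrow>
     ('a set \<times> 'a set) set" where
  "contact P M n z =
     {(N1, N2). N1 \<in> submanifolds_through P M z \<and> N2 \<in> submanifolds_through P M z \<and>
        (\<exists>V1 V2. \<exists>\<phi>1 \<phi>2 :: real ^ 'p \<Rightarrow> 'a.
           local_parametrization M N1 z V1 \<phi>1 \<and> local_parametrization M N2 z V2 \<phi>2 \<and>
           (\<forall>(U, c)\<in>charts M. z \<in> U \<longrightarrow>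
              (\<forall>vs. length vs \<le> n \<longrightarrow> iter_deriv vs (c \<circ> \<phi>1) 0 = iter_deriv vs (c \<circ> \<phi>2) 0)))}"

text \<open>The space of \<open>n\<close>-th order jets; a jet is a point together with a class of submanifolds
  through this point modulo contact of order \<open>n\<close>.\<close>

definition jets ::
    "'p::finite itself \<Rightarrow> ('a::topological_space, 'e::euclidean_space) manifold \<Rightarrow> nat \<Rightarrow>
     ('a \<times> 'a set set) set" where
  "jets P M n = (SIGMA z : UNIV. submanifolds_through P M z // contact P M n z)"

definition base_point :: "'a \<times> 'a set set \<Rightarrow> 'a" where
  "base_point j = fst j"

definition prolong :: "('g \<Rightarrow> 'a \<Rightarrow> 'a) \<Rightarrow> 'g \<Rightarrow> 'a \<times> 'a set set \<Rightarrow> 'a \<times> 'a set set" where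
  "prolong act g = (\<lambda>(z, C). (act g z, (\<lambda>N. act g ` N) ` C))"

definition jets_over ::
    "'p::finite itself \<Rightarrow> ('a::topological_space, 'e::euclidean_space) manifold \<Rightarrow> nat \<Rightarrow> 'a set \<Rightarrow>
     ('a \<times> 'a set set) set" where
  "jets_over P M n S = {j \<in> jets P M n. base_point j \<in> S}"

definition attains_max_orbit_dim ::
    "'p::finite itself \<Rightarrow> 'g monoid \<Rightarrow> ('g, 'f::euclidean_space) manifold \<Rightarrow>
     ('a::topological_space, 'e::euclidean_space) manifold \<Rightarrow> ('g \<Rightarrow> 'a \<Rightarrow> 'a) \<Rightarrow> nat \<Rightarrow> bool" where
  "attains_max_orbit_dim P G A M act n \<longleftrightarrow>
     (\<exists>j\<in>jets P M n. \<forall>k. \<forall>i\<in>jets P M k.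
        orbit_dim G A (prolong act) i \<le> orbit_dim G A (prolong act) j)"

definition order_of_stabilization ::
    "'p::finite itself \<Rightarrow> 'g monoid \<Rightarrow> ('g, 'f::euclidean_space) manifold \<Rightarrow>
     ('a::topological_space, 'e::euclidean_space) manifold \<Rightarrow> ('g \<Rightarrow> 'a \<Rightarrow> 'a) \<Rightarrow> nat \<Rightarrow> bool" where
  "order_of_stabilization P G A M act n \<longleftrightarrow>
     attains_max_orbit_dim P G A M act n \<and> (\<forall>k<n. \<not> attains_max_orbit_dim P G A M act k)"

end

theory Submission
  imports Defs
begin

text \<open>Two group elements that move \<open>z\<close> into the slice differ by a left factor in \<open>H\<close>.  Applied to
  \<open>\<rho>\<^sub>s (g \<cdot> j) g\<close> and \<open>\<rho>\<^sub>s j\<close>, both of which move the base point of \<open>j\<close> into the slice, this gives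
  \<open>\<rho>\<^sub>s (g \<cdot> j) = h \<rho>\<^sub>s j g\<^sup>-\<^sup>1\<close> with \<open>h \<in> H\<close>, hence \<open>\<iota>\<^sub>0 (g \<cdot> j) = h \<cdot> \<iota>\<^sub>0 j\<close>; the equivariance of
  \<open>\<rho>\<^sub>H\<close> then contributes a factor \<open>h\<^sup>-\<^sup>1\<close> that cancels \<open>h\<close>.\<close>

lemma base_point_prolong: "base_point (prolong act g j) = act g (base_point j)"
  by (simp add: base_point_def prolong_def split: prod.split)

text \<open>Prolongation acts by taking images of the point and of each representative submanifold,
  so the composition rule passes from points of the manifold to arbitrary pairs.\<close>

lemma prolong_mult:
  assumes action: "group_action G UNIV act" and "g \<in> carrier G" "h \<in> carrier G"
  shows "prolong act (g \<otimes>\<^bsub>G\<^esub> h) j = prolong act g (prolong act h j)"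
proof -
  interpret group_action G UNIV act by (rule action)
  have "act (g \<otimes>\<^bsub>G\<^esub> h) x = act g (act h x)" for x
    using assms(2,3) composition_rule[of x g h] by simp
  then show ?thesis
    by (simp add: prolong_def image_image split: prod.split)
qed

lemma slice_ex1_orbit:
  assumes "slice G A M act S H"
  shows "\<exists>!w. w \<in> S \<inter> orbit G act z"
proof -
  have "\<forall>z. \<exists>!w. w \<in> S \<inter> orbit G act z"
    using assms unfolding slice_def cross_section_def by (elim conjE)
  then show ?thesis by (rule spec)
qed

lemma slice_meets_orbit:
  assumes "slice G A M act S H"
  obtains g where "g \<in> carrier G" "act g z \<in> S"
proof -
  obtain w where "w \<in> S" "w \<in> orbit G act z"
    using slice_ex1_orbit[OF assms, of z] by (elim ex1E IntE)
  then show ?thesis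
    using that unfolding orbit_def by blast
qed

lemma slice_orbit_unique:
  assumes "slice G A M act S H" "a \<in> carrier G" "b \<in> carrier G" "act a z \<in> S" "act b z \<in> S"
  shows "act a z = act b z"
proof -
  have "act a z \<in> S \<inter> orbit G act z" "act b z \<in> S \<inter> orbit G act z"
    using assms(2-5) unfolding orbit_def by blast+
  then show ?thesis
    using slice_ex1_orbit[OF assms(1), of z] by (metis (no_types, lifting))
qed

lemma slice_isotropy:
  assumes "slice G A M act S H" "z \<in> S"
  shows "stabilizer G act z = H"
  using assms by (simp add: slice_def)

text \<open>\<open>H\<close> is introduced as a mere set; it inherits the subgroup property from
  being the stabilizer of a point of \<open>S\<close>.\<close>

lemma slice_isotropy_subgroup:
  assumes action: "group_action G UNIV act" and sl: "slice G A M act S H"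
  shows "subgroup H G"
proof -
  interpret group_action G UNIV act by (rule action)
  \<comment> \<open>\<open>undefined\<close> serves as an arbitrary point: its orbit meets
    \<open>S\<close>, so \<open>S\<close> is nonempty.\<close>
  obtain g where g: "g \<in> carrier G" "act g undefined \<in> S"
    using slice_meets_orbit[OF sl] by blast
  then show ?thesis
    using stabilizer_subgroup[of "act g undefined"] slice_isotropy[OF sl g(2)] by simp
qed

text \<open>The orbit of \<open>z\<close> meets \<open>S\<close> only once, so \<open>a\<close> and
  \<open>b\<close> carry \<open>z\<close> to the same point. Hence \<open>b\<close> times the
  inverse of \<open>a\<close> fixes that point, whose stabilizer is \<open>H\<close>.\<close>

lemma slice_left_factor:
  assumes action: "group_action G UNIV act" and sl: "slice G A M act S H"
    and a: "a \<in> carrier G" "act a z \<in> S" and b: "b \<in> carrier G" "act b z \<in> S"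
  shows "b \<otimes>\<^bsub>G\<^esub> inv\<^bsub>G\<^esub> a \<in> H"
proof -
  interpret group_action G UNIV act by (rule action)
  interpret G: group G using group_hom group_hom.axioms(1) by blast
  have "act (b \<otimes>\<^bsub>G\<^esub> inv\<^bsub>G\<^esub> a) (act a z) = act ((b \<otimes>\<^bsub>G\<^esub> inv\<^bsub>G\<^esub> a) \<otimes>\<^bsub>G\<^esub> a) z"
    using composition_rule[of z "b \<otimes>\<^bsub>G\<^esub> inv\<^bsub>G\<^esub> a" a] a(1) b(1) by simp
  also have "\<dots> = act a z"
    using slice_orbit_unique[OF sl a(1) b(1) a(2) b(2)] a(1) b(1) by (simp add: G.m_assoc)
  finally have "b \<otimes>\<^bsub>G\<^esub> inv\<^bsub>G\<^esub> a \<in> stabilizer G act (act a z)"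
    using a(1) b(1) by (simp add: stabilizer_def)
  then show ?thesis
    using slice_isotropy[OF sl a(2)] by simp
qed

text \<open>This justifies the definite description in \<open>slice_map\<close>: any other candidate
  \<open>g\<close> is \<open>a\<close> multiplied from the left by an element of \<open>H\<close>,
  hence gives the same right coset.\<close>

lemma slice_map_eq:
  assumes action: "group_action G UNIV act" and sl: "slice G A M act S H"
    and a: "a \<in> carrier G" "act a z \<in> S"
  shows "slice_map G act S H z = H #>\<^bsub>G\<^esub> a"
  unfolding slice_map_def
proof (rule the_equality)
  interpret group_action G UNIV act by (rule action)
  interpret G: group G using group_hom group_hom.axioms(1) by blast
  fix C assume "\<exists>g\<in>carrier G. act g z \<in> S \<and> C = H #>\<^bsub>G\<^esub> g"
  then obtain g where g: "g \<in> carrier G" "act g z \<in> S" "C = H #>\<^bsub>G\<^esub> g" by blast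
  have H: "subgroup H G" by (rule slice_isotropy_subgroup[OF action sl])
  have "g \<otimes>\<^bsub>G\<^esub> inv\<^bsub>G\<^esub> a \<in> H" by (rule slice_left_factor[OF action sl a g(1,2)])
  moreover have "g = (g \<otimes>\<^bsub>G\<^esub> inv\<^bsub>G\<^esub> a) \<otimes>\<^bsub>G\<^esub> a"
    using g(1) a(1) by (simp add: G.m_assoc)
  ultimately have "g \<in> H #>\<^bsub>G\<^esub> a" unfolding r_coset_def by blast
  then show "C = H #>\<^bsub>G\<^esub> a"
    using G.repr_independence[OF _ a(1) H] g(3) by simp
qed (use a in blast)

text \<open>Conversely, every representative of the coset moves \<open>z\<close> into
  \<open>S\<close>, because \<open>H\<close> fixes the point where the orbit meets \<open>S\<close>.
  This makes the values of an arbitrary section usable.\<close>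

lemma slice_map_representative:
  assumes action: "group_action G UNIV act" and sl: "slice G A M act S H"
    and a: "a \<in> carrier G" "H #>\<^bsub>G\<^esub> a = slice_map G act S H z"
  shows "act a z \<in> S"
proof -
  interpret group_action G UNIV act by (rule action)
  interpret G: group G using group_hom group_hom.axioms(1) by blast
  have H: "subgroup H G" by (rule slice_isotropy_subgroup[OF action sl])
  obtain g where g: "g \<in> carrier G" "act g z \<in> S"
    using slice_meets_orbit[OF sl] by blast
  have "a \<in> H #>\<^bsub>G\<^esub> g"
    using G.rcos_self[OF a(1) H] a(2) slice_map_eq[OF action sl g] by simp
  then obtain h where h: "h \<in> H" "a = h \<otimes>\<^bsub>G\<^esub> g" unfolding r_coset_def by blast
  then have "h \<in> carrier G" "act h (act g z) = act g z"
    using slice_isotropy[OF sl g(2)] by (auto simp: stabilizer_def)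
  then show ?thesis
    using composition_rule[of z h g] g h(2) by simp
qed

theorem proposition2p1p9:
  fixes G :: "'g::{t2_space,second_countable_topology} monoid"
    and A :: "('g, 'f::euclidean_space) manifold"
    and M :: "('a::{t2_space,second_countable_topology}, 'e::euclidean_space) manifold"
    and act :: "'g \<Rightarrow> 'a \<Rightarrow> 'a"
    and S :: "'a set" and H :: "'g set"
    and W :: "'g set set" and s :: "'g set \<Rightarrow> 'g"
    and n :: nat
    and D :: "('a \<times> 'a set set) set" and \<rho>H :: "'a \<times> 'a set set \<Rightarrow> 'g"
    and coset_map :: "'a \<times> 'a set set \<Rightarrow> 'g set"
    and \<rho>s :: "'a \<times> 'a set set \<Rightarrow> 'g"
    and \<iota>0 :: "'a \<times> 'a set set \<Rightarrow> 'a \<times> 'a set set"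
    and \<rho>G :: "'a \<times> 'a set set \<Rightarrow> 'g"
    and dom_G :: "('a \<times> 'a set set) set"
  assumes lie: "lie_group G A"
    and mfd: "smooth_manifold M"
    and action: "lie_group_action G A M act"
    and regular: "regular_action G A act"
    and slice: "slice G A M act S H"
    and coset_map: "coset_map = (\<lambda>j. slice_map G act S H (base_point j))"
    and section_s: "local_section G A H W s"
    and section_e: "H \<in> W" "s H = \<one>\<^bsub>G\<^esub>"
    and rho_s: "\<rho>s = (\<lambda>j. s (coset_map j))"
    and iota0: "\<iota>0 = (\<lambda>j. prolong act (\<rho>s j) j)"
    and stab_order: "order_of_stabilization TYPE('p::finite) G A M act n"
    and frame_dom: "D \<subseteq> jets_over TYPE('p) M n S"
    and frame: "moving_frame_on G H (prolong act) D \<rho>H"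
    and rho_G: "\<rho>G = (\<lambda>j. \<rho>H (\<iota>0 j) \<otimes>\<^bsub>G\<^esub> \<rho>s j)"
    and dom_G: "dom_G = {j \<in> jets TYPE('p) M n. coset_map j \<in> W \<and> \<iota>0 j \<in> D}"
  shows "\<forall>g\<in>carrier G. \<forall>j\<in>dom_G. prolong act g j \<in> dom_G \<longrightarrow>
           \<rho>G (prolong act g j) = \<rho>G j \<otimes>\<^bsub>G\<^esub> inv\<^bsub>G\<^esub> g"
proof (intro ballI impI)
  fix g j assume g: "g \<in> carrier G" and j: "j \<in> dom_G" and gj: "prolong act g j \<in> dom_G"
  have act: "group_action G UNIV act" using action by (simp add: lie_group_action_def)
  interpret group_action G UNIV act by (rule act)
  interpret G: group G using group_hom group_hom.axioms(1) by blast
  \<comment> \<open>The section property says that \<open>\<rho>s i\<close> represents the coset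
    \<open>coset_map i\<close>.\<close>
  have \<rho>s: "\<rho>s i \<in> carrier G \<and> act (\<rho>s i) (base_point i) \<in> S" if "i \<in> dom_G" for i
  proof -
    have "coset_map i \<in> W" using that dom_G by simp
    then have "\<rho>s i \<in> carrier G" "H #>\<^bsub>G\<^esub> \<rho>s i = slice_map G act S H (base_point i)"
      using section_s unfolding local_section_def rho_s coset_map by auto
    then show ?thesis using slice_map_representative[OF act slice] by blast
  qed
  define a b where "a = \<rho>s j" and "b = \<rho>s (prolong act g j)"
  have a: "a \<in> carrier G" "act a (base_point j) \<in> S"
    and b: "b \<in> carrier G" "act b (act g (base_point j)) \<in> S"
    using \<rho>s[OF j] \<rho>s[OF gj] by (simp_all add: a_def b_def base_point_prolong)
  have bg: "b \<otimes>\<^bsub>G\<^esub> g \<in> carrier G" "act (b \<otimes>\<^bsub>G\<^esub> g) (base_point j) \<in> S"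
    using b g composition_rule[of "base_point j" b g] by simp_all
  define h where "h = (b \<otimes>\<^bsub>G\<^esub> g) \<otimes>\<^bsub>G\<^esub> inv\<^bsub>G\<^esub> a"
  have hH: "h \<in> H" unfolding h_def by (rule slice_left_factor[OF act slice a bg])
  have h: "h \<in> carrier G" using a b g by (simp add: h_def)
  have ha: "h \<otimes>\<^bsub>G\<^esub> a = b \<otimes>\<^bsub>G\<^esub> g" using a b g by (simp add: h_def G.m_assoc)
  \<comment> \<open>Both sides are the prolonged action of
    \<open>b \<otimes> g = h \<otimes> a\<close> on \<open>j\<close>.\<close>
  have \<iota>0: "\<iota>0 (prolong act g j) = prolong act h (\<iota>0 j)"
    using prolong_mult[OF act b(1) g, of j] prolong_mult[OF act h a(1), of j] ha
    by (simp add: iota0 a_def b_def)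
  \<comment> \<open>The frame is only locally equivariant, so both points must lie in
    \<open>D\<close>; this is where \<open>j\<close> and its translate both being in
    \<open>dom_G\<close> enters.\<close>
  have D: "\<iota>0 j \<in> D" "prolong act h (\<iota>0 j) \<in> D" using j gj dom_G \<iota>0 by auto
  define r where "r = \<rho>H (\<iota>0 j)"
  have r: "\<rho>H (\<iota>0 (prolong act g j)) = r \<otimes>\<^bsub>G\<^esub> inv\<^bsub>G\<^esub> h"
    using frame D hH unfolding moving_frame_on_def \<iota>0 r_def by blast
  have "r \<in> H" using frame D unfolding moving_frame_on_def r_def by blast
  then have rG: "r \<in> carrier G"
    using subgroup.mem_carrier[OF slice_isotropy_subgroup[OF act slice]] by blast
  \<comment> \<open>Expanding the inverse of \<open>h\<close> yields \<open>a\<close>, the inverse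
    of \<open>g\<close> and the inverse of \<open>b\<close>, the last of which cancels against
    \<open>b\<close>.\<close>
  have "inv\<^bsub>G\<^esub> h \<otimes>\<^bsub>G\<^esub> b = a \<otimes>\<^bsub>G\<^esub> inv\<^bsub>G\<^esub> g"
    using a(1) b(1) g by (simp add: h_def G.inv_mult_group G.m_assoc)
  then have "(r \<otimes>\<^bsub>G\<^esub> inv\<^bsub>G\<^esub> h) \<otimes>\<^bsub>G\<^esub> b = (r \<otimes>\<^bsub>G\<^esub> a) \<otimes>\<^bsub>G\<^esub> inv\<^bsub>G\<^esub> g"
    using a(1) b(1) g h rG by (simp add: G.m_assoc)
  then show "\<rho>G (prolong act g j) = \<rho>G j \<otimes>\<^bsub>G\<^esub> inv\<^bsub>G\<^esub> g"
    by (simp add: rho_G r flip: a_def b_def r_def)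
qed

end
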